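(* For every $m\in\{2,4,6,8,10\}$, the hyperbolic quadric $Q^+(7,3)$ contains an $m$-ovoid which is a disjoint union of $2$-ovoids of $Q^+(7,3)$.
   Context: $Q^+(7,3)$ is the set of points of $\mathrm{PG}(7,3)$ that are zeros of the quadratic form $X_0X_1+X_2X_3+X_4X_5+X_6X_7$ on $\mathbb{F}_3^8$. Its generators are the maximal totally singular subspaces, which are projective $3$-spaces. An $m$-ovoid of $Q^+(7,3)$ is a set of points of $Q^+(7,3)$ meeting every generator in exactly $m$ points. *)

theory Defs
  imports "HOL-Analysis.Cartesian_Space" "HOL-Library.Numeral_Type" "HOL-Library.Disjoint_Sets"
begin

text \<open>
  Subspaces of \<open>PG(7,K)\<close> are represented by the corresponding linear subspaces of \<open>K\<^sup>8\<close>,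
  where \<open>K\<close> is a field and coordinates are indexed by \<open>0, \<dots>, 7\<close> in the numeral type \<open>8\<close>;
  incidence is inclusion.
\<close>

definition hyp_form :: "'a::field ^ 8 \<Rightarrow> 'a" where
  "hyp_form x = x $ 0 * x $ 1 + x $ 2 * x $ 3 + x $ 4 * x $ 5 + x $ 6 * x $ 7"

definition totally_singular :: "('a::field ^ 8) set \<Rightarrow> bool" where
  "totally_singular W \<longleftrightarrow> vec.subspace W \<and> (\<forall>x\<in>W. hyp_form x = 0)"

definition proj_points :: "('a::field ^ 8) set set" where
  "proj_points = {P. vec.subspace P \<and> vec.dim P = 1}"

definition hyp_quadric :: "('a::field ^ 8) set set" where
  "hyp_quadric = {P \<in> proj_points. \<forall>x\<in>P. hyp_form x = 0}"

definition generators :: "('a::field ^ 8) set set" where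
  "generators = {W. totally_singular W \<and> (\<forall>W'. totally_singular W' \<and> W \<subseteq> W' \<longrightarrow> W' = W)}"

definition is_m_ovoid :: "nat \<Rightarrow> ('a::field ^ 8) set set \<Rightarrow> bool" where
  "is_m_ovoid m S \<longleftrightarrow>
     S \<subseteq> hyp_quadric \<and> (\<forall>W\<in>generators. card {P \<in> S. P \<subseteq> W} = m)"

end

theory Submission
  imports Defs "HOL-Library.Indicator_Function"
begin

text \<open>
  Over \<open>F\<^sub>3\<close> the form \<open>hyp_form\<close> is isometric to the sum of eight squares, with orthonormal
  coordinates indexed by the affine space \<open>F\<^sub>2\<^sup>3\<close>. For a sign vector \<open>s\<close>, the 28 points spanned by the
  vectors \<open>s \<cdot> 1\<^sub>P\<close> with \<open>|P| = 6\<close> form an ovoid, and the 56 points with \<open>|P| = 3\<close> form a 2-ovoid.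
  The sign vectors given by the eight characters of \<open>F\<^sub>2\<^sup>3\<close> (the rows of a Hadamard matrix) pairwise
  agree in exactly four places, so their ovoids are pairwise disjoint; pairing them gives four
  2-ovoids of points of weight 6, and a 2-ovoid of points of weight 3 is the fifth.

  Both kinds of sets have the property that a singular vector \<open>y \<noteq> 0\<close> is orthogonal to \<open>10k - 9\<close>
  of the \<open>28k\<close> points if it spans one of them, and to \<open>10k\<close> otherwise. Counting orthogonal
  pairs between a generator and the set then shows that they meet in exactly \<open>k\<close> points.
\<close>

section \<open>Orthonormal coordinates and the candidate point sets\<close>

text \<open>
  On each half, \<open>x\<^sub>0x\<^sub>1 + x\<^sub>2x\<^sub>3 = (x\<^sub>0 + x\<^sub>1)\<^sup>2 - (x\<^sub>0 - x\<^sub>1)\<^sup>2 + (x\<^sub>2 + x\<^sub>3)\<^sup>2 - (x\<^sub>2 - x\<^sub>3)\<^sup>2\<close> modulo 3, and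
  \<open>- a\<^sup>2 - b\<^sup>2 = (a + b)\<^sup>2 + (a - b)\<^sup>2\<close>.
\<close>
definition coord :: "'a::field ^ 8 \<Rightarrow> bool \<times> bool \<times> bool \<Rightarrow> 'a" where
  "coord x = (\<lambda>(b, p, q).
     let (x0, x1, x2, x3) =
       if b then (x $ 4, x $ 5, x $ 6, x $ 7) else (x $ 0, x $ 1, x $ 2, x $ 3)
     in if p then (if q then x0 - x1 + x2 - x3 else x0 - x1 - x2 + x3)
        else (if q then x2 + x3 else x0 + x1))"

definition bil :: "'a::field ^ 8 \<Rightarrow> 'a ^ 8 \<Rightarrow> 'a" where
  "bil x y = (\<Sum>i\<in>UNIV. coord x i * coord y i)"

text \<open>\<open>inv coord\<close> is a genuine inverse once \<open>coord\<close> is bijective,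
  which \<open>bij_coord\<close> gives over a field of three elements.\<close>

definition block_vec :: "(bool \<times> bool \<times> bool \<Rightarrow> 'a::field) \<Rightarrow> (bool \<times> bool \<times> bool) set \<Rightarrow> 'a ^ 8" where
  "block_vec s P = inv coord (\<lambda>i. s i * indicator P i)"

text \<open>Vectors are kept instead of points so that orthogonality can be counted vector by
  vector. For a sign vector \<open>s\<close> and \<open>r\<close> equal to 3 or 6, the set contains
  exactly one of the two nonzero vectors of each point that it represents.\<close>

definition signed_blocks :: "(bool \<times> bool \<times> bool \<Rightarrow> 'a::field) \<Rightarrow> nat \<Rightarrow> ('a ^ 8) set" where
  "signed_blocks s r = block_vec s ` {P. card P = r}"

definition points :: "('a::field ^ 8) set \<Rightarrow> ('a ^ 8) set set" where
  "points A = (\<lambda>v. vec.span {v}) ` A"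

text \<open>The dot product over F_2 of two bit triples, linear in each argument; this makes each
  \<open>sign a\<close> a character.\<close>

fun odd_inter :: "bool \<times> bool \<times> bool \<Rightarrow> bool \<times> bool \<times> bool \<Rightarrow> bool" where
  "odd_inter (a, b, c) (x, y, z) \<longleftrightarrow> ((a \<and> x) \<noteq> ((b \<and> y) \<noteq> (c \<and> z)))"

definition sign :: "bool \<times> bool \<times> bool \<Rightarrow> bool \<times> bool \<times> bool \<Rightarrow> 'a::field" where
  "sign a i = (if odd_inter a i then - 1 else 1)"

text \<open>The index type has exactly five elements. The last bit \<open>c\<close> pairs off the
  eight characters, giving four unions of two ovoids; \<open>None\<close> carries the set of weight
  3.\<close>

definition two_ovoid :: "(bool \<times> bool) option \<Rightarrow> ('a::field ^ 8) set set" where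
  "two_ovoid = case_option (points (signed_blocks (sign (False, False, False)) 3))
     (\<lambda>(a, b). \<Union>c\<in>UNIV. points (signed_blocks (sign (a, b, c)) 6))"

section \<open>The index cube and the bilinear form\<close>

lemma sum_cube:
  "sum f (UNIV :: (bool \<times> bool \<times> bool) set) =
   f (False,False,False) + f (False,False,True) + f (False,True,False) + f (False,True,True) +
   f (True,False,False) + f (True,False,True) + f (True,True,False) + f (True,True,True)"
proof -
  have "sum f (UNIV :: (bool \<times> bool \<times> bool) set) = (\<Sum>a\<in>UNIV. \<Sum>b\<in>UNIV. \<Sum>c\<in>UNIV. f (a, b, c))"
    by (simp only: UNIV_Times_UNIV[symmetric] sum.cartesian_product')
  then show ?thesis
    by (simp add: UNIV_bool add_ac)
qed

lemma card_cube: "CARD(bool \<times> bool \<times> bool) = 8"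
  by simp

text \<open>The sum of two distinct linear functionals on F_2^3 is nonzero, so it takes the values 0
  and 1 four times each. The finitely many pairs are checked by evaluation.\<close>

lemma card_odd_inter_eq:
  assumes "a \<noteq> b"
  shows "card {i. odd_inter a i = odd_inter b i} = 4"
    and "card {i. odd_inter a i \<noteq> odd_inter b i} = 4"
proof -
  have "\<forall>a b. a \<noteq> b \<longrightarrow> length (filter (\<lambda>i. odd_inter a i = odd_inter b i) enum_class.enum) = 4 \<and>
          length (filter (\<lambda>i. odd_inter a i \<noteq> odd_inter b i) enum_class.enum) = 4"
    by code_simp
  moreover have "card {i. Q i} = length (filter Q enum_class.enum)" for Q :: "bool \<times> bool \<times> bool \<Rightarrow> bool"
    by (simp add: enum_distinct distinct_length_filter UNIV_enum[symmetric])
  ultimately show "card {i. odd_inter a i = odd_inter b i} = 4"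
    and "card {i. odd_inter a i \<noteq> odd_inter b i} = 4"
    using assms by presburger+
qed

lemma coord_add: "coord (x + y) i = coord x i + coord y i"
  by (cases i) (auto simp: coord_def)

lemma coord_scale: "coord (c *s x) i = c * coord x i"
  by (cases i) (auto simp: coord_def algebra_simps)

lemma coord_neg: "coord (- x) i = - coord x i"
  using coord_scale[of "- 1" x i] by simp

lemma bil_commute: "bil x y = bil y x"
  by (simp add: bil_def mult.commute)

lemma bil_add_left: "bil (x + y) z = bil x z + bil y z"
  by (simp add: bil_def coord_add algebra_simps sum.distrib)

lemma bil_scale_left: "bil (c *s x) z = c * bil x z"
  by (simp add: bil_def coord_scale sum_distrib_left mult.assoc)

lemma bil_add_right: "bil z (x + y) = bil z x + bil z y"
  by (simp add: bil_commute[of z] bil_add_left)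

lemma bil_scale_right: "bil z (c *s x) = c * bil z x"
  by (simp add: bil_commute[of z] bil_scale_left)

lemma bil_0_left [simp]: "bil 0 z = 0"
  using bil_scale_left[of 0 0 z] by simp

section \<open>Numerical profiles of singular vectors\<close>

text \<open>
  The number of \<open>r\<close>-subsets of zero sum for a vector over \<open>F\<^sub>3\<close> with \<open>n0\<close>, \<open>n1\<close>, \<open>n2\<close> entries
  equal to 0, 1, -1; the subset contains \<open>a\<close>, \<open>b\<close>, \<open>c\<close> of them.
\<close>
definition zero_sum_count :: "nat \<Rightarrow> nat \<Rightarrow> nat \<Rightarrow> nat \<Rightarrow> nat" where
  "zero_sum_count n0 n1 n2 r = (\<Sum>a\<le>n0. \<Sum>b\<le>n1. \<Sum>c\<le>n2.
     if a + b + c = r \<and> b mod 3 = c mod 3 then (n0 choose a) * (n1 choose b) * (n2 choose c) else 0)"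

text \<open>The exceptional values 1 and 11 occur exactly when the nonzero entries are all equal and
  there are \<open>r\<close> of them.\<close>

lemma zero_sum_count_table:
  shows "zero_sum_count 5 3 0 6 = 10"
    and "zero_sum_count 5 2 1 6 = 10"
    and "zero_sum_count 5 1 2 6 = 10"
    and "zero_sum_count 5 0 3 6 = 10"
    and "zero_sum_count 2 6 0 6 = 1"
    and "zero_sum_count 2 5 1 6 = 10"
    and "zero_sum_count 2 4 2 6 = 10"
    and "zero_sum_count 2 3 3 6 = 10"
    and "zero_sum_count 2 2 4 6 = 10"
    and "zero_sum_count 2 1 5 6 = 10"
    and "zero_sum_count 2 0 6 6 = 1"
    and "zero_sum_count 5 3 0 3 = 11"
    and "zero_sum_count 5 2 1 3 = 20"
    and "zero_sum_count 5 1 2 3 = 20"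
    and "zero_sum_count 5 0 3 3 = 11"
    and "zero_sum_count 2 6 0 3 = 20"
    and "zero_sum_count 2 5 1 3 = 20"
    and "zero_sum_count 2 4 2 3 = 20"
    and "zero_sum_count 2 3 3 3 = 20"
    and "zero_sum_count 2 2 4 3 = 20"
    and "zero_sum_count 2 1 5 3 = 20"
    and "zero_sum_count 2 0 6 3 = 20"
  by code_simp+

text \<open>Here \<open>a\<close>, \<open>b\<close>, \<open>c\<close> count the entries 0, 1, -1 of
  a nonzero singular vector. Its weight \<open>b + c\<close> is a positive multiple of 3 and at most
  8, hence 3 or 6.\<close>

lemma singular_profile_cases:
  fixes a b c :: nat
  assumes "a + b + c = 8" "(b + c) mod 3 = 0" "b + c \<noteq> 0"
  shows "(a, b, c) \<in> {(5,3,0),(5,2,1),(5,1,2),(5,0,3),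
      (2,6,0),(2,5,1),(2,4,2),(2,3,3),(2,2,4),(2,1,5),(2,0,6)}"
proof -
  have "b + c = 3 \<and> a = 5 \<or> b + c = 6 \<and> a = 2"
    using assms by presburger
  then consider "b + c = 3" "a = 5" | "b + c = 6" "a = 2"
    by blast
  then show ?thesis
  proof cases
    case 1
    then have "c = 3 - b" "b = 0 \<or> b = 1 \<or> b = 2 \<or> b = 3"
      by linarith+
    with 1 show ?thesis by (elim disjE) simp_all
  next
    case 2
    then have "c = 6 - b" "b = 0 \<or> b = 1 \<or> b = 2 \<or> b = 3 \<or> b = 4 \<or> b = 5 \<or> b = 6"
      by linarith+
    with 2 show ?thesis by (elim disjE) simp_all
  qed
qed

lemma zero_sum_count_eq:
  assumes "r = 6 \<and> k = 1 \<or> r = 3 \<and> k = 2"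
    and "(a, b, c) \<in> {(5,3,0),(5,2,1),(5,1,2),(5,0,3),
      (2,6,0),(2,5,1),(2,4,2),(2,3,3),(2,2,4),(2,1,5),(2,0,6)}"
  shows "int (zero_sum_count a b c r) =
    (if b = r \<and> c = 0 \<or> c = r \<and> b = 0 then 10 * k - 9 else 10 * k)"
  using assms
  by (elim disjE insertE emptyE Pair_inject conjE) (simp_all add: zero_sum_count_table[unfolded One_nat_def])

lemma exhaust_8: "(i::8) \<in> {0, 1, 2, 3, 4, 5, 6, 7}"
proof (induct i)
  case (of_int z)
  then have "z = 0 \<or> z = 1 \<or> z = 2 \<or> z = 3 \<or> z = 4 \<or> z = 5 \<or> z = 6 \<or> z = 7"
    by fastforce
  then show ?case by auto
qed

section \<open>Arithmetic in the field of three elements\<close>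

context
  fixes ty :: "'a::field itself"
  assumes card3: "CARD('a) = 3"
begin

text \<open>In characteristic 2, an element \<open>t\<close> outside \<open>{0, 1}\<close> would
  bring \<open>t + 1\<close> as a fourth element.\<close>

lemma one_neq_minus_one: "(1::'a) \<noteq> - 1"
proof
  assume h: "(1::'a) = - 1"
  have fin: "finite (UNIV::'a set)"
    using card3 by (simp add: card_ge_0_finite)
  have "{0, 1::'a} \<noteq> UNIV"
    using card3 by (metis card_2_iff num.distinct(5) numeral_eq_iff zero_neq_one)
  then obtain t :: 'a where t: "t \<noteq> 0" "t \<noteq> 1"
    by blast
  have n: "t + 1 \<noteq> 0" "t + 1 \<noteq> 1" "t + 1 \<noteq> t"
    using t h by (auto simp: eq_neg_iff_add_eq_0[symmetric])
  have "card {0, 1, t, t + 1} \<le> CARD('a)"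
    by (rule card_mono) (use fin in auto)
  moreover have "card {0, 1, t, t + 1} = 4"
    using t n by auto
  ultimately show False
    using card3 by simp
qed

lemma elements: "(x::'a) \<in> {0, 1, - 1}"
proof -
  have "card {0, 1, - 1 :: 'a} = 3"
    using one_neq_minus_one by auto
  then have "{0, 1, - 1 :: 'a} = UNIV"
    using card3 by (intro card_subset_eq) (auto simp: card_ge_0_finite)
  then show ?thesis by blast
qed

lemma one_plus_one: "(1::'a) + 1 = - 1"
proof -
  have "(1::'a) + 1 \<noteq> 1" "(1::'a) + 1 \<noteq> 0"
    using one_neq_minus_one by (metis add_cancel_right_right zero_neq_one) (metis eq_neg_iff_add_eq_0 one_neq_minus_one)
  then show ?thesis
    using elements[of "1 + 1"] by blast
qed

lemma three_eq_0: "(3::'a) = 0"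
proof -
  have "(3::'a) = (1 + 1) + 1"
    by simp
  then show ?thesis
    unfolding one_plus_one by simp
qed

lemma of_nat_eq_iff_mod_3: "(of_nat b :: 'a) = of_nat c \<longleftrightarrow> b mod 3 = c mod 3"
proof -
  have three: "(of_nat 3 :: 'a) = 0"
    using three_eq_0 by simp
  have red: "(of_nat n :: 'a) = of_nat (n mod 3)" for n
    by (metis add_0 div_mult_mod_eq mult_zero_right of_nat_add of_nat_mult three)
  have vals: "(of_nat 0 :: 'a) = 0" "(of_nat 1 :: 'a) = 1" "(of_nat 2 :: 'a) = - 1"
    using one_plus_one by simp_all
  have "inj_on (of_nat :: nat \<Rightarrow> 'a) {0, 1, 2}"
    using one_neq_minus_one one_neq_minus_one[symmetric]
    by (auto simp only: inj_on_def insert_iff empty_iff vals) simp_all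
  moreover have "b mod 3 \<in> {0,1,2}" "c mod 3 \<in> {0,1,2}"
    by auto
  ultimately show ?thesis
    using red[of b] red[of c] by (metis inj_onD)
qed

section \<open>Counting the subsets on which a vector sums to zero\<close>

lemma sum_eq_card_diff:
  fixes y :: "'i::finite \<Rightarrow> 'a"
  shows "sum y P = of_nat (card (P \<inter> {i. y i = 1})) - of_nat (card (P \<inter> {i. y i = - 1}))"
proof -
  have "sum y P = (\<Sum>i\<in>P. of_bool (y i = 1) - of_bool (y i = - 1))"
  proof (rule sum.cong)
    show "y i = of_bool (y i = 1) - of_bool (y i = - 1)" for i
      using elements[of "y i"] one_neq_minus_one by auto
  qed simp
  also have "\<dots> = of_nat (card (P \<inter> {i. y i = 1})) - of_nat (card (P \<inter> {i. y i = - 1}))"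
    by (simp add: sum_subtractf Int_def)
  finally show ?thesis .
qed

lemma card_split:
  fixes y :: "'i \<Rightarrow> 'a"
  assumes "finite P"
  shows "card P = card {i \<in> P. y i = 0} + card {i \<in> P. y i = 1} + card {i \<in> P. y i = - 1}"
proof -
  have "P = {i \<in> P. y i = 0} \<union> {i \<in> P. y i = 1} \<union> {i \<in> P. y i = - 1}"
    using elements by auto
  also have "card \<dots> = card ({i \<in> P. y i = 0} \<union> {i \<in> P. y i = 1}) + card {i \<in> P. y i = - 1}"
    using assms one_neq_minus_one by (intro card_Un_disjoint) auto
  also have "card ({i \<in> P. y i = 0} \<union> {i \<in> P. y i = 1}) = card {i \<in> P. y i = 0} + card {i \<in> P. y i = 1}"
    using assms by (intro card_Un_disjoint) auto
  finally show ?thesis .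
qed

text \<open>A subset is determined by its traces on the three level sets of \<open>y\<close>. Its
  sum vanishes exactly when the numbers of chosen entries 1 and -1 agree modulo 3, so the subsets
  correspond to triples of traces with admissible sizes.\<close>

lemma card_zero_sum_subsets:
  fixes y :: "'i::finite \<Rightarrow> 'a"
  defines "C \<equiv> \<lambda>v. {i. y i = v}"
  shows "card {P. card P = r \<and> sum y P = 0} =
    zero_sum_count (card (C 0)) (card (C 1)) (card (C (- 1))) r"
proof -
  let ?K = "\<lambda>v a. {X. X \<subseteq> C v \<and> card X = a}"
  let ?D = "{..card (C 0)} \<times> {..card (C 1)} \<times> {..card (C (- 1))}"
  let ?T = "{t \<in> ?D. fst t + fst (snd t) + snd (snd t) = r \<and> fst (snd t) mod 3 = snd (snd t) mod 3}"
  let ?S = "SIGMA t:?T. ?K 0 (fst t) \<times> ?K 1 (fst (snd t)) \<times> ?K (- 1) (snd (snd t))"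
  let ?f = "\<lambda>P. ((card (P \<inter> C 0), card (P \<inter> C 1), card (P \<inter> C (- 1))),
                 (P \<inter> C 0, P \<inter> C 1, P \<inter> C (- 1)))"
  let ?g = "\<lambda>(t, (X, Y, Z)). X \<union> Y \<union> Z"
  have disj: "C 0 \<inter> C 1 = {}" "C 0 \<inter> C (- 1) = {}" "C 1 \<inter> C (- 1) = {}"
    using one_neq_minus_one by (auto simp: C_def)
  have cov: "P = P \<inter> C 0 \<union> P \<inter> C 1 \<union> P \<inter> C (- 1)" for P
    using elements by (auto simp: C_def)
  have zero: "card P = r \<and> sum y P = 0 \<longleftrightarrow>
      card (P \<inter> C 0) + card (P \<inter> C 1) + card (P \<inter> C (- 1)) = r \<and>
      card (P \<inter> C 1) mod 3 = card (P \<inter> C (- 1)) mod 3" for P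
    unfolding C_def card_split[OF finite, of P y] Collect_conj_eq[of "\<lambda>i. i \<in> P"] Collect_mem_eq sum_eq_card_diff[of y P]
    by (simp add: of_nat_eq_iff_mod_3)
  have parts: "(X \<union> Y \<union> Z) \<inter> C 0 = X" "(X \<union> Y \<union> Z) \<inter> C 1 = Y" "(X \<union> Y \<union> Z) \<inter> C (- 1) = Z"
    if "X \<subseteq> C 0" "Y \<subseteq> C 1" "Z \<subseteq> C (- 1)" for X Y Z
    using that disj by blast+
  have "bij_betw ?f {P. card P = r \<and> sum y P = 0} ?S"
  proof (rule bij_betwI[where g = ?g])
    show "?f \<in> {P. card P = r \<and> sum y P = 0} \<rightarrow> ?S"
      unfolding zero by (auto intro!: card_mono)
    show "?g \<in> ?S \<rightarrow> {P. card P = r \<and> sum y P = 0}"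
      unfolding zero by (auto simp: parts)
    show "?g (?f P) = P" for P
      using cov[of P] by simp
    show "?f (?g t) = t" if "t \<in> ?S" for t
      using that by (elim SigmaE) (auto simp only: parts mem_Collect_eq mem_Sigma_iff fst_conv snd_conv prod.case)
  qed
  then have "card {P. card P = r \<and> sum y P = 0} = card ?S"
    by (rule bij_betw_same_card)
  also have "\<dots> = (\<Sum>t\<in>?T. (card (C 0) choose fst t) * (card (C 1) choose fst (snd t)) * (card (C (- 1)) choose snd (snd t)))"
    by (subst card_SigmaI) (auto simp: card_cartesian_product n_subsets mult.assoc)
  also have "\<dots> = (\<Sum>t\<in>?D. if fst t + fst (snd t) + snd (snd t) = r \<and> fst (snd t) mod 3 = snd (snd t) mod 3
       then (card (C 0) choose fst t) * (card (C 1) choose fst (snd t)) * (card (C (- 1)) choose snd (snd t)) else 0)"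
    by (subst sum.inter_filter) auto
  finally show ?thesis
    by (simp add: zero_sum_count_def sum.cartesian_product case_prod_beta)
qed

lemma card_orthogonal_subsets:
  fixes y :: "'i::finite \<Rightarrow> 'a"
  assumes "CARD('i) = 8" "(\<Sum>i\<in>UNIV. y i * y i) = 0" "y \<noteq> (\<lambda>_. 0)"
    and rk: "r = 6 \<and> k = 1 \<or> r = 3 \<and> k = 2"
  shows "int (card {P. card P = r \<and> sum y P = 0}) =
    (if \<exists>P. card P = r \<and> (y = indicator P \<or> y = (\<lambda>i. - indicator P i)) then 10 * k - 9 else 10 * k)"
proof -
  define n where "n = (\<lambda>v. card {i. y i = v})"
  have nv: "card {i. y i = v} = n v" for v
    by (simp add: n_def)
  have tot: "n 0 + n 1 + n (- 1) = 8"
    using card_split[OF finite, of UNIV y] assms(1) by (simp add: n_def)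
  \<comment> \<open>Every nonzero element of the field has square 1, so the sum of squares is the
    weight modulo 3.\<close>
  have "(\<Sum>i\<in>UNIV. y i * y i) = (\<Sum>i\<in>UNIV. of_bool (y i \<noteq> 0))"
  proof (rule sum.cong)
    show "y i * y i = of_bool (y i \<noteq> 0)" for i
      using elements[of "y i"] by auto
  qed simp
  also have "\<dots> = of_nat (card {i. y i \<noteq> 0})"
    by (simp add: Int_def)
  finally have "card {i. y i \<noteq> 0} mod 3 = 0"
    using of_nat_eq_iff_mod_3[of "card {i. y i \<noteq> 0}" 0] assms(2) by simp
  moreover have "card {i. y i \<noteq> 0} = n 1 + n (- 1)"
    using card_split[OF finite, of UNIV y] card_Diff_subset[of "{i. y i = 0}" UNIV]
    by (simp add: n_def Compl_eq_Diff_UNIV[symmetric] Collect_neg_eq[symmetric])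
  moreover have "card {i. y i \<noteq> 0} \<noteq> 0"
    using assms(3) by auto
  ultimately have "(n 1 + n (- 1)) mod 3 = 0" "n 1 + n (- 1) \<noteq> 0"
    by simp_all
  from singular_profile_cases[OF tot this] have cases: "(n 0, n 1, n (- 1)) \<in> {(5,3,0),(5,2,1),(5,1,2),(5,0,3),
      (2,6,0),(2,5,1),(2,4,2),(2,3,3),(2,2,4),(2,1,5),(2,0,6)}"
    .
  \<comment> \<open>Being plus or minus an indicator means that only one nonzero value occurs, so
    the exceptional case can be read off the profile.\<close>
  have ind: "(\<exists>P. card P = r \<and> (y = indicator P \<or> y = (\<lambda>i. - indicator P i))) \<longleftrightarrow>
      n 1 = r \<and> n (- 1) = 0 \<or> n (- 1) = r \<and> n 1 = 0"
  proof -
    have a: "y i = indicator P i \<longleftrightarrow> (y i = 1 \<longleftrightarrow> i \<in> P) \<and> y i \<noteq> - 1"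
      and b: "y i = - indicator P i \<longleftrightarrow> (y i = - 1 \<longleftrightarrow> i \<in> P) \<and> y i \<noteq> 1" for i P
      using elements[of "y i"] one_neq_minus_one one_neq_minus_one[symmetric]
      by (auto simp: indicator_def)
    have A: "y = indicator P \<longleftrightarrow> {i. y i = 1} = P \<and> {i. y i = - 1} = {}"
      and B: "y = (\<lambda>i. - indicator P i) \<longleftrightarrow> {i. y i = - 1} = P \<and> {i. y i = 1} = {}" for P
      unfolding fun_eq_iff a b by blast+
    show ?thesis
      unfolding A B n_def by (auto simp: card_eq_0_iff)
  qed
  show ?thesis
    unfolding ind card_zero_sum_subsets nv
    by (rule zero_sum_count_eq[OF rk cases])
qed

section \<open>The quadratic form in the orthonormal coordinates\<close>

lemma finite_vec: "finite (A :: ('a ^ 8) set)"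
proof -
  have "card (UNIV :: ('a ^ 8) set) > 0"
    by (simp add: card3)
  then show ?thesis
    by (meson card_ge_0_finite finite_subset subset_UNIV)
qed

lemma two_eq: "(2::'a) = - 1"
  using one_plus_one by simp

lemma bil_self: "bil x x = hyp_form (x :: 'a ^ 8)"
proof -
  \<comment> \<open>Expanding the squares, each hyperbolic pair of coordinates \<open>a\<close>,
    \<open>b\<close> contributes \<open>x $ a * x $ b + 3 * e a b\<close>.\<close>
  define e where "e = (\<lambda>a b. x $ a * x $ a + x $ b * x $ b - x $ a * x $ b)"
  have "bil x x = hyp_form x + 3 * (e 0 1 + e 2 3 + e 4 5 + e 6 7)"
    by (simp add: bil_def sum_cube coord_def hyp_form_def e_def algebra_simps)
  then show ?thesis
    by (simp add: three_eq_0)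
qed

text \<open>The polar form is twice \<open>bil\<close>, and 2 = -1.\<close>

lemma hyp_form_add: "hyp_form (x + y) = hyp_form x + hyp_form y - bil x (y :: 'a ^ 8)"
proof -
  have "hyp_form (x + y) = hyp_form x + hyp_form y + 2 * bil x y"
    by (simp add: bil_self[symmetric] bil_add_left bil_add_right bil_commute[of y x])
  then show ?thesis
    by (simp add: two_eq)
qed

lemma hyp_form_scale: "hyp_form (c *s x) = c * c * hyp_form (x :: 'a ^ 8)"
  by (simp add: hyp_form_def algebra_simps)

text \<open>Injectivity is linear algebra on each half, where doubling can be cancelled because 2 =
  -1. Surjectivity follows since both spaces have 3^8 elements.\<close>

lemma bij_coord: "bij (coord :: 'a ^ 8 \<Rightarrow> _)"
proof -
  have double: "a = b" if "a + a = b + b" for a b :: 'a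
    using that two_eq by (simp add: mult_2[symmetric])
  have inj: "inj (coord :: 'a ^ 8 \<Rightarrow> _)"
  proof (rule injI)
    fix x y :: "'a ^ 8"
    assume "coord x = coord y"
    then have eq: "coord x i = coord y i" for i
      by simp
    have h: "x $ 0 + x $ 1 = y $ 0 + y $ 1" "x $ 2 + x $ 3 = y $ 2 + y $ 3"
      "x $ 0 - x $ 1 + x $ 2 - x $ 3 = y $ 0 - y $ 1 + y $ 2 - y $ 3"
      "x $ 0 - x $ 1 - x $ 2 + x $ 3 = y $ 0 - y $ 1 - y $ 2 + y $ 3"
      "x $ 4 + x $ 5 = y $ 4 + y $ 5" "x $ 6 + x $ 7 = y $ 6 + y $ 7"
      "x $ 4 - x $ 5 + x $ 6 - x $ 7 = y $ 4 - y $ 5 + y $ 6 - y $ 7"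
      "x $ 4 - x $ 5 - x $ 6 + x $ 7 = y $ 4 - y $ 5 - y $ 6 + y $ 7"
      using eq[of "(False,False,False)"] eq[of "(False,False,True)"]
        eq[of "(False,True,True)"] eq[of "(False,True,False)"]
        eq[of "(True,False,False)"] eq[of "(True,False,True)"]
        eq[of "(True,True,True)"] eq[of "(True,True,False)"]
      by (simp_all add: coord_def)
    have solve: "a = a' \<and> b = b' \<and> c = c' \<and> d = d'"
      if "a + b = a' + b'" "c + d = c' + d'" "a - b + c - d = a' - b' + c' - d'"
        "a - b - c + d = a' - b' - c' + d'" for a b c d a' b' c' d' :: 'a
    proof -
      \<comment> \<open>The sum and the difference of the last two equations isolate twice
        \<open>a - b\<close> and twice \<open>c - d\<close>; the first two equations then separate
        the variables.\<close>
      have "(a - b + c - d) + (a - b - c + d) = (a' - b' + c' - d') + (a' - b' - c' + d')"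
        "(a - b + c - d) - (a - b - c + d) = (a' - b' + c' - d') - (a' - b' - c' + d')"
        using that by simp_all
      then have "(a - b) + (a - b) = (a' - b') + (a' - b')" "(c - d) + (c - d) = (c' - d') + (c' - d')"
        by (simp_all only: diff_add_eq add_diff_eq diff_diff_eq2) (simp_all add: algebra_simps)
      then have d: "a - b = a' - b'" "c - d = c' - d'"
        by (blast dest: double)+
      have "(a + b) + (a - b) = (a' + b') + (a' - b')" "(c + d) + (c - d) = (c' + d') + (c' - d')"
        using d that by simp_all
      then have "a + a = a' + a'" "c + c = c' + c'"
        by (simp_all add: algebra_simps)
      then have "a = a'" "c = c'"
        by (blast dest: double)+
      with that show ?thesis by simp
    qed
    have "x $ i = y $ i" for i
      using exhaust_8[of i] solve[OF h(1-4)] solve[OF h(5-8)] by (elim insertE emptyE) simp_all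
    then show "x = y"
      by (simp add: vec_eq_iff)
  qed
  \<comment> \<open>Coordinate functions are wrapped as vectors, so that domain and codomain are
    vector types with 3^8 elements.\<close>
  define F where "F = (\<lambda>x :: 'a ^ 8. (vec_lambda (coord x) :: 'a ^ (bool \<times> bool \<times> bool)))"
  have injF: "inj F"
    using inj by (auto simp: F_def inj_def vec_lambda_inject)
  have "range F = UNIV"
  proof (rule card_subset_eq)
    have "card (UNIV :: ('a ^ (bool \<times> bool \<times> bool)) set) > 0"
      by (simp add: card3)
    then show "finite (UNIV :: ('a ^ (bool \<times> bool \<times> bool)) set)"
      by (rule card_ge_0_finite)
    show "card (range F) = card (UNIV :: ('a ^ (bool \<times> bool \<times> bool)) set)"
      using card_image[OF injF] by (simp add: card3)
  qed simp
  then have "\<exists>x. coord x = f" for f :: "bool \<times> bool \<times> bool \<Rightarrow> 'a"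
    unfolding F_def by (metis (no_types, lifting) UNIV_I imageE vec_lambda_inverse)
  then have "surj (coord :: 'a ^ 8 \<Rightarrow> _)"
    by (metis surjI)
  with inj show ?thesis
    by (simp add: bij_def)
qed

lemma coord_block_vec: "coord (block_vec s P :: 'a ^ 8) = (\<lambda>i. s i * indicator P i)"
  unfolding block_vec_def by (rule surj_f_inv_f[OF bij_is_surj[OF bij_coord]])

lemma coord_eq_iff: "coord (x :: 'a ^ 8) = coord y \<longleftrightarrow> x = y"
  using bij_is_inj[OF bij_coord] by (simp add: inj_eq)

lemma bil_block_vec: "bil y (block_vec s P :: 'a ^ 8) = (\<Sum>i\<in>P. s i * coord y i)"
proof -
  have "bil y (block_vec s P) = (\<Sum>i\<in>UNIV. if i \<in> P then s i * coord y i else 0)"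
    unfolding bil_def coord_block_vec by (rule sum.cong) (auto simp: indicator_def)
  then show ?thesis
    by (simp add: sum.If_cases)
qed

lemma vec_span_singleton: "vec.span {v :: 'a ^ 8} = {0, v, - v}"
proof -
  have "range (\<lambda>c. c *s v) = (\<lambda>c. c *s v) ` {0, 1, - 1}"
    using elements by blast
  then show ?thesis
    by (simp add: vec.span_singleton)
qed

lemma span_singleton_eq_iff:
  "vec.span {u} = vec.span {v} \<longleftrightarrow> u = v \<or> u = - (v :: 'a ^ 8)"
proof
  assume "vec.span {u} = vec.span {v}"
  then have "u \<in> {0, v, - v}" "v \<in> {0, u, - u}"
    unfolding vec_span_singleton by blast+
  then show "u = v \<or> u = - v"
    by auto
qed (auto simp: vec_span_singleton)

section \<open>Generators and the double count\<close>

lemma totally_singular_bil: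
  assumes "totally_singular W" "x \<in> W" "y \<in> W"
  shows "bil x y = (0 :: 'a)"
  using assms hyp_form_add[of x y] by (simp add: totally_singular_def vec.subspace_add)

text \<open>Adjoining \<open>v\<close> to \<open>W\<close> keeps every vector singular, so
  maximality of \<open>W\<close> forces \<open>v\<close> to lie in it.\<close>

lemma generator_perp:
  assumes "W \<in> generators" "hyp_form v = (0::'a)" "\<And>w. w \<in> W \<Longrightarrow> bil w v = 0"
  shows "v \<in> W"
proof -
  have W: "totally_singular W" and sub: "vec.subspace W"
    using assms(1) by (auto simp: generators_def totally_singular_def)
  have "totally_singular (vec.span (insert v W))"
    unfolding totally_singular_def
  proof (intro conjI ballI)
    fix x assume "x \<in> vec.span (insert v W)"
    then obtain c where "x - c *s v \<in> W"
      using vec.span_eq_iff[THEN iffD2, OF sub] by (auto simp: vec.span_insert)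
    then obtain w where w: "w \<in> W" "x = w + c *s v"
      by (metis diff_add_cancel)
    then have "hyp_form w = 0"
      using W by (simp add: totally_singular_def)
    then show "hyp_form x = 0"
      using w assms(2,3) by (simp add: hyp_form_add hyp_form_scale bil_scale_right)
  qed simp
  moreover have "W \<subseteq> vec.span (insert v W)"
    by (meson vec.span_superset subset_insertI subset_trans)
  ultimately have "vec.span (insert v W) = W"
    using assms(1) by (auto simp: generators_def)
  then show ?thesis
    by (metis insertI1 vec.span_base)
qed

text \<open>Pairing with \<open>v\<close> is a nonzero linear functional on \<open>W\<close>; its
  three fibres are translates of one another by suitable multiples of \<open>w0\<close>.\<close>

lemma card_perp:
  assumes "vec.subspace W" "w0 \<in> W" "bil w0 v \<noteq> (0::'a)"
  shows "3 * card {w \<in> W. bil w v = 0} = card W"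
proof -
  let ?K = "\<lambda>c. {w \<in> W. bil w v = c}"
  have eq: "card (?K c) = card (?K 0)" for c
  proof (rule bij_betw_same_card[symmetric])
    define u where "u = (c / bil w0 v) *s w0"
    have u: "u \<in> W" "bil u v = c"
      using assms by (simp_all add: u_def vec.subspace_scale bil_scale_left)
    show "bij_betw (\<lambda>w. w + u) (?K 0) (?K c)"
    proof (rule bij_betwI[where g = "\<lambda>w. w - u"])
      have "bil (w - u) v = bil w v - c" for w
        using bil_add_left[of "w - u" u v] u by simp
      then show "(\<lambda>w. w - u) \<in> ?K c \<rightarrow> ?K 0"
        using u assms(1) by (auto intro: vec.subspace_diff)
    qed (use u assms(1) in \<open>auto simp: bil_add_left vec.subspace_add\<close>)
  qed
  show ?thesis
    using card_split[OF finite_vec, of W "\<lambda>w. bil w v"] eq[of 1] eq[of "- 1"] by simp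
qed

text \<open>
  Counting orthogonal pairs in \<open>W \<times> A\<close> by rows and by columns gives \<open>(2 |W| + 54) (k - |A \<inter> W|) = 0\<close>,
  so the dimension of \<open>W\<close> need not be known.
\<close>
lemma card_inter_generator:
  fixes A :: "('a ^ 8) set" and k :: int
  assumes W: "W \<in> generators"
    and zero: "0 \<notin> A"
    and neg: "\<And>v. v \<in> A \<Longrightarrow> - v \<notin> A"
    and sing: "\<And>v. v \<in> A \<Longrightarrow> hyp_form v = 0"
    and cardA: "int (card A) = 28 * k"
    and perp: "\<And>y. hyp_form y = 0 \<Longrightarrow> y \<noteq> 0 \<Longrightarrow>
      int (card {v \<in> A. bil y v = 0}) = (if y \<in> A \<or> - y \<in> A then 10 * k - 9 else 10 * k)"
  shows "int (card (A \<inter> W)) = k"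
proof -
  have ts: "totally_singular W" and sub: "vec.subspace W"
    using W by (auto simp: generators_def totally_singular_def)
  note [simp] = finite_vec
  define N where "N = int (card W)"
  define j where "j = int (card (A \<inter> W))"
  \<comment> \<open>The row of the zero vector contains all \<open>28 * k = 10 * k + 18 * k\<close>
    elements of \<open>A\<close>. By \<open>neg\<close>, at most one of the last two indicators is
    1.\<close>
  have "(\<Sum>w\<in>W. int (card {v \<in> A. bil w v = 0})) =
      (\<Sum>w\<in>W. 10 * k + 18 * k * of_bool (w = 0) - 9 * of_bool (w \<in> A) - 9 * of_bool (- w \<in> A))"
  proof (rule sum.cong)
    fix w assume "w \<in> W"
    then have "hyp_form w = 0"
      using ts by (simp add: totally_singular_def)
    then show "int (card {v \<in> A. bil w v = 0}) =
        10 * k + 18 * k * of_bool (w = 0) - 9 * of_bool (w \<in> A) - 9 * of_bool (- w \<in> A)"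
      using perp[of w] neg[of w] zero cardA by (cases "w = 0") auto
  qed simp
  also have "\<dots> = 10 * k * N + 18 * k - 9 * j - 9 * int (card {w \<in> W. - w \<in> A})"
    using vec.subspace_0[OF sub] Collect_conv_if[of 0 "\<lambda>w. w \<in> W"]
    by (simp add: sum_subtractf sum.distrib sum_distrib_left[symmetric] N_def j_def Int_def conj_commute)
  also have "card {w \<in> W. - w \<in> A} = card (A \<inter> W)"
    by (rule bij_betw_same_card[OF bij_betwI[where f = uminus and g = uminus]])
      (use vec.subspace_neg[OF sub] in auto)
  finally have rows: "(\<Sum>w\<in>W. int (card {v \<in> A. bil w v = 0})) = 10 * k * N + 18 * k - 18 * j"
    by (simp add: j_def)
  have "3 * (\<Sum>w\<in>W. int (card {v \<in> A. bil w v = 0})) = 3 * (\<Sum>w\<in>W. \<Sum>v\<in>A. of_bool (bil w v = 0))"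
    by (simp add: Int_def)
  also have "\<dots> = 3 * (\<Sum>v\<in>A. \<Sum>w\<in>W. of_bool (bil w v = 0))"
    by (subst sum.swap) simp
  also have "\<dots> = (\<Sum>v\<in>A. int (3 * card {w \<in> W. bil w v = 0}))"
    by (simp add: Int_def sum_distrib_left)
  \<comment> \<open>All of \<open>W\<close> is orthogonal to a column \<open>v\<close> in
    \<open>W\<close>. For any other \<open>v\<close>, \<open>generator_perp\<close> provides a
    non-orthogonal vector of \<open>W\<close>, so only a third of \<open>W\<close> remains; tripling
    avoids the division.\<close>
  also have "\<dots> = (\<Sum>v\<in>A. N + 2 * N * of_bool (v \<in> W))"
  proof (rule sum.cong)
    fix v assume v: "v \<in> A"
    show "int (3 * card {w \<in> W. bil w v = 0}) = N + 2 * N * of_bool (v \<in> W)"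
    proof (cases "v \<in> W")
      case True
      then have "{w \<in> W. bil w v = 0} = W"
        using totally_singular_bil[OF ts] by auto
      with True show ?thesis by (simp add: N_def)
    next
      case False
      then obtain w where "w \<in> W" "bil w v \<noteq> 0"
        using generator_perp[OF W sing[OF v]] by blast
      from card_perp[OF sub this] False show ?thesis
        by (simp add: N_def)
    qed
  qed simp
  also have "\<dots> = 28 * k * N + 2 * N * j"
    by (simp add: sum.distrib sum_distrib_left[symmetric] cardA j_def Int_def)
  \<comment> \<open>Rows and columns, both tripled, read
    \<open>30 * k * N + 54 * k - 54 * j = 28 * k * N + 2 * N * j\<close>.\<close>
  finally have "(2 * N + 54) * (k - j) = 0"
    unfolding rows by (simp add: algebra_simps)
  moreover have "2 * N + 54 > 0"
    by (simp add: N_def)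
  ultimately show ?thesis
    by (simp add: j_def)
qed

section \<open>The ovoids and 2-ovoids of a sign vector\<close>

context
  fixes s :: "bool \<times> bool \<times> bool \<Rightarrow> 'a"
  assumes s_unit: "s i = 1 \<or> s i = - 1"
begin

lemma s_sq: "s i * s i = 1"
  using s_unit[of i] by auto

lemma s_mult_cancel: "a = s i * b \<longleftrightarrow> s i * a = b"
proof -
  have "s i * (s i * x) = x" for x
    using s_sq[of i] by (simp flip: mult.assoc)
  then show ?thesis by metis
qed

text \<open>Multiplication by \<open>s\<close> is an involution on coordinates, so it can be moved
  to the side of \<open>y\<close>.\<close>

lemma mem_signed_blocks:
  "y \<in> signed_blocks s r \<longleftrightarrow> (\<exists>P. card P = r \<and> (\<lambda>i. s i * coord y i) = indicator P)"
  unfolding signed_blocks_def image_iff coord_eq_iff[symmetric] coord_block_vec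
  by (simp add: fun_eq_iff s_mult_cancel)

lemma inj_block_vec: "inj (block_vec s)"
proof (rule injI)
  fix P Q assume "block_vec s P = block_vec s Q"
  then have "s i * indicator P i = s i * indicator Q i" for i
    by (metis coord_block_vec)
  then have "(indicator P i :: 'a) = indicator Q i" for i
    by (metis s_mult_cancel)
  then show "P = Q"
    by (metis indicator_eq_1_iff set_eqI)
qed

text \<open>Multiplying coordinates by \<open>s\<close> preserves the dot product, so orthogonality
  of \<open>y\<close> to a block vector says that the twisted vector sums to zero on the block. The
  subset count then supplies the hypotheses of the double count.\<close>

lemma is_m_ovoid_signed_blocks:
  assumes rk: "r = 6 \<and> k = 1 \<or> r = 3 \<and> k = 2"
  shows "is_m_ovoid k (points (signed_blocks s r))"
proof -
  let ?A = "signed_blocks s r"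
  have sing: "hyp_form v = 0" if "v \<in> ?A" for v
  proof -
    from that obtain P where P: "card P = r" "v = block_vec s P"
      by (auto simp: signed_blocks_def)
    have "hyp_form v = (\<Sum>i\<in>P. s i * s i)"
      unfolding bil_self[symmetric] P(2) bil_block_vec coord_block_vec by (rule sum.cong) auto
    then have "hyp_form v = of_nat r"
      by (simp add: s_sq P(1))
    then show ?thesis
      using rk of_nat_eq_iff_mod_3[of r 0] by auto
  qed
  have zero: "0 \<notin> ?A"
  proof
    assume "0 \<in> ?A"
    then obtain P where P: "card P = r" "(\<lambda>i. s i * coord 0 i) = indicator P"
      by (auto simp: mem_signed_blocks)
    have "coord (0::'a ^ 8) i = 0" for i
      using coord_scale[of 0 0 i] by simp
    then have "P = {}"
      using P(2) by (auto simp: fun_eq_iff indicator_def split: if_splits)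
    with P(1) rk show False by auto
  qed
  have neg: "- v \<notin> ?A" if "v \<in> ?A" for v
  proof
    assume "- v \<in> ?A"
    with that obtain P Q where P: "card P = r" "(\<lambda>i. s i * coord v i) = indicator P"
      and "card Q = r" "(\<lambda>i. - (s i * coord v i)) = indicator Q"
      by (auto simp: mem_signed_blocks coord_neg)
    then have eq: "- indicator P i = (indicator Q i :: 'a)" for i
      by (metis (no_types))
    have "P = {}"
    proof (rule ccontr)
      assume "P \<noteq> {}"
      then obtain i where "i \<in> P" by blast
      with eq[of i] show False
        using one_neq_minus_one[symmetric] by (auto simp: indicator_def split: if_splits)
    qed
    with P(1) rk show False by auto
  qed
  have perp: "int (card {v \<in> ?A. bil y v = 0}) =
      (if y \<in> ?A \<or> - y \<in> ?A then 10 * int k - 9 else 10 * int k)"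
    if y: "hyp_form y = 0" "y \<noteq> 0" for y
  proof -
    define z where "z = (\<lambda>i. s i * coord y i)"
    have "{v \<in> ?A. bil y v = 0} = block_vec s ` {P. card P = r \<and> sum z P = 0}"
      by (auto simp: signed_blocks_def bil_block_vec z_def)
    then have "card {v \<in> ?A. bil y v = 0} = card {P. card P = r \<and> sum z P = 0}"
      by (simp add: card_image inj_on_subset[OF inj_block_vec])
    moreover have "(\<Sum>i\<in>UNIV. z i * z i) = 0"
    proof -
      have "z i * z i = coord y i * coord y i" for i
        using s_unit[of i] by (auto simp: z_def)
      then show ?thesis
        using y(1) by (simp add: bil_self[symmetric] bil_def)
    qed
    moreover have "z \<noteq> (\<lambda>_. 0)"
    proof
      assume "z = (\<lambda>_. 0)"
      then have "coord y = coord (0 *s y)"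
        using s_unit unfolding coord_scale z_def fun_eq_iff
        by (metis mult_eq_0_iff mult_zero_left neg_equal_0_iff_equal zero_neq_one)
      then show False
        using y(2) by (simp add: coord_eq_iff)
    qed
    moreover have "r = 6 \<and> int k = 1 \<or> r = 3 \<and> int k = 2"
      using rk by auto
    moreover have "y \<in> ?A \<or> - y \<in> ?A \<longleftrightarrow>
        (\<exists>P. card P = r \<and> (z = indicator P \<or> z = (\<lambda>i. - indicator P i)))"
    proof -
      have "(\<lambda>i. - z i) = f \<longleftrightarrow> z = (\<lambda>i. - f i)" for f
        by (auto simp: fun_eq_iff minus_equation_iff)
      then show ?thesis
        by (auto simp: mem_signed_blocks coord_neg z_def[symmetric] z_def[THEN fun_cong, symmetric])
    qed
    ultimately show ?thesis
      using card_orthogonal_subsets[OF card_cube, of z r "int k"] by simp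
  qed
  have "card ?A = 8 choose r"
  proof -
    have "card {P :: (bool \<times> bool \<times> bool) set. P \<subseteq> UNIV \<and> card P = r} = 8 choose r"
      by (subst n_subsets) simp_all
    then show ?thesis
      unfolding signed_blocks_def by (simp add: card_image inj_on_subset[OF inj_block_vec])
  qed
  \<comment> \<open>These are \<open>28 * k\<close> for \<open>k = 2\<close> and
    \<open>k = 1\<close> respectively.\<close>
  moreover have "8 choose 3 = (56::nat)" "8 choose 6 = (28::nat)"
    by code_simp+
  ultimately have cardA: "int (card ?A) = 28 * int k"
    using rk by auto
  have "points ?A \<subseteq> hyp_quadric"
  proof
    fix p assume "p \<in> points ?A"
    then obtain v where v: "v \<in> ?A" "p = vec.span {v}"
      by (auto simp: points_def)
    have "v \<noteq> 0"
      using v(1) zero by auto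
    then have "vec.dim p = 1"
      unfolding v(2) by (simp add: vec.dim_span)
    moreover have "hyp_form x = 0" if "x \<in> p" for x
      using that sing[OF v(1)] hyp_form_scale[of "- 1" v] hyp_form_scale[of 0 v]
      unfolding v(2) vec_span_singleton by auto
    ultimately show "p \<in> hyp_quadric"
      by (simp add: hyp_quadric_def proj_points_def v(2))
  qed
  moreover have "card {p \<in> points ?A. p \<subseteq> W} = k" if W: "W \<in> generators" for W
  proof -
    have sub: "vec.subspace W"
      using W by (auto simp: generators_def totally_singular_def)
    have "vec.span {v} \<subseteq> W \<longleftrightarrow> v \<in> W" for v
      using vec.span_minimal[OF _ sub, of "{v}"] vec.span_base[of v "{v}"] by auto
    then have "{p \<in> points ?A. p \<subseteq> W} = (\<lambda>v. vec.span {v}) ` (?A \<inter> W)"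
      by (auto simp: points_def)
    \<comment> \<open>Two vectors span the same point only if they agree up to sign, and
      \<open>neg\<close> excludes opposite vectors.\<close>
    moreover have "inj_on (\<lambda>v. vec.span {v}) (?A \<inter> W)"
    proof (rule inj_onI)
      fix u v assume "u \<in> ?A \<inter> W" "v \<in> ?A \<inter> W" "vec.span {u} = vec.span {v}"
      then show "u = v"
        using zero neg[of v] span_singleton_eq_iff[of u v] by auto
    qed
    ultimately have "card {p \<in> points ?A. p \<subseteq> W} = card (?A \<inter> W)"
      by (simp add: card_image)
    then show ?thesis
      using card_inter_generator[OF W zero neg sing cardA perp] by simp
  qed
  ultimately show ?thesis
    by (simp add: is_m_ovoid_def)
qed

end

section \<open>Disjointness\<close>

text \<open>A shared point makes two block vectors equal up to sign. Since \<open>s\<close> and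
  \<open>t\<close> vanish nowhere, the supports coincide, and the two sign vectors agree or are
  opposite on this common block.\<close>

lemma common_point:
  fixes s t :: "bool \<times> bool \<times> bool \<Rightarrow> 'a"
  assumes "\<And>i. s i \<noteq> 0" "\<And>i. t i \<noteq> 0"
    and "p \<in> points (signed_blocks s r)" "p \<in> points (signed_blocks t r')"
  obtains P where "card P = r" "card P = r'" "(\<forall>i\<in>P. s i = t i) \<or> (\<forall>i\<in>P. s i = - t i)"
proof -
  from assms(3,4) obtain P Q where PQ: "card P = r" "card Q = r'"
    and "vec.span {block_vec s P} = vec.span {block_vec t Q}"
    by (auto simp: points_def signed_blocks_def)
  then consider "block_vec s P = block_vec t Q" | "block_vec s P = - block_vec t Q"
    by (auto simp: span_singleton_eq_iff)
  then show thesis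
  proof cases
    case 1
    then have eq: "s i * indicator P i = t i * indicator Q i" for i
      by (metis coord_block_vec)
    have "i \<in> P \<longleftrightarrow> i \<in> Q" for i
      using eq[of i] assms(1,2)[of i] by (cases "i \<in> P"; cases "i \<in> Q") simp_all
    moreover have "s i = t i" if "i \<in> P" "i \<in> Q" for i
      using eq[of i] that by simp
    ultimately show thesis
      using that[of P] PQ by (metis set_eqI)
  next
    case 2
    then have "coord (block_vec s P) i = coord (- block_vec t Q) i" for i
      by simp
    then have eq: "s i * indicator P i = - (t i * indicator Q i)" for i
      by (simp add: coord_neg coord_block_vec)
    have "i \<in> P \<longleftrightarrow> i \<in> Q" for i
      using eq[of i] assms(1,2)[of i] by (cases "i \<in> P"; cases "i \<in> Q") simp_all
    moreover have "s i = - t i" if "i \<in> P" "i \<in> Q" for i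
      using eq[of i] that by simp
    ultimately show thesis
      using that[of P] PQ by (metis set_eqI)
  qed
qed

lemma is_m_ovoid_sign:
  assumes "r = 6 \<and> k = 1 \<or> r = 3 \<and> k = 2"
  shows "is_m_ovoid k (points (signed_blocks (sign a :: _ \<Rightarrow> 'a) r))"
  by (rule is_m_ovoid_signed_blocks[OF _ assms]) (simp add: sign_def)

lemma sign_eq_iff:
  "sign a i = (sign b i :: 'a) \<longleftrightarrow> odd_inter a i = odd_inter b i"
  "sign a i = (- sign b i :: 'a) \<longleftrightarrow> odd_inter a i \<noteq> odd_inter b i"
  using one_neq_minus_one one_neq_minus_one[symmetric] by (simp_all add: sign_def)

text \<open>A shared point would need six places where two distinct characters all agree or all
  differ, but there are only four of each.\<close>

lemma points_signed_blocks_disjoint: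
  assumes "a \<noteq> b"
  shows "points (signed_blocks (sign a :: _ \<Rightarrow> 'a) 6) \<inter> points (signed_blocks (sign b) 6) = {}"
proof (rule ccontr)
  assume "\<not> ?thesis"
  then obtain p where "p \<in> points (signed_blocks (sign a :: _ \<Rightarrow> 'a) 6)"
    "p \<in> points (signed_blocks (sign b :: _ \<Rightarrow> 'a) 6)"
    by blast
  then obtain P where P: "card P = 6"
    "(\<forall>i\<in>P. sign a i = (sign b i :: 'a)) \<or> (\<forall>i\<in>P. sign a i = - (sign b i :: 'a))"
    by (rule common_point[rotated 2]) (simp_all add: sign_def)
  then have "P \<subseteq> {i. odd_inter a i = odd_inter b i} \<or> P \<subseteq> {i. odd_inter a i \<noteq> odd_inter b i}"
    unfolding sign_eq_iff by blast
  then have "card P \<le> card {i. odd_inter a i = odd_inter b i} \<or>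
      card P \<le> card {i. odd_inter a i \<noteq> odd_inter b i}"
    by (elim disjE) (rule disjI1 disjI2, erule card_mono[rotated], rule finite)+
  with P(1) show False
    unfolding card_odd_inter_eq[OF assms] by simp
qed

lemma points_signed_blocks_disjoint':
  assumes "r \<noteq> r'"
  shows "points (signed_blocks (sign a :: _ \<Rightarrow> 'a) r) \<inter> points (signed_blocks (sign b) r') = {}"
proof (rule ccontr)
  assume "\<not> ?thesis"
  then obtain p where "p \<in> points (signed_blocks (sign a :: _ \<Rightarrow> 'a) r)"
    "p \<in> points (signed_blocks (sign b :: _ \<Rightarrow> 'a) r')"
    by blast
  then show False
    by (rule common_point[rotated 2]) (use assms in \<open>simp_all add: sign_def\<close>)
qed

section \<open>Unions of disjoint ovoids\<close>

lemma is_m_ovoid_UN: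
  fixes G :: "'j \<Rightarrow> ('a ^ 8) set set"
  assumes "finite J" "disjoint_family_on G J" "\<And>i. i \<in> J \<Longrightarrow> is_m_ovoid k (G i)"
  shows "is_m_ovoid (k * card J) (\<Union>i\<in>J. G i)"
proof -
  have fin: "finite X" for X :: "('a ^ 8) set set"
    by (rule finite_subset[OF _ finite_Pow_iff[THEN iffD2, OF finite_vec[of UNIV]]]) simp
  have "card {P \<in> \<Union>i\<in>J. G i. P \<subseteq> W} = k * card J" if "W \<in> generators" for W
  proof -
    have "{P \<in> \<Union>i\<in>J. G i. P \<subseteq> W} = (\<Union>i\<in>J. {P \<in> G i. P \<subseteq> W})"
      by blast
    also have "card \<dots> = (\<Sum>i\<in>J. card {P \<in> G i. P \<subseteq> W})"
      using assms(1,2) by (intro card_UN_disjoint) (auto simp: fin disjoint_family_on_def)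
    also have "\<dots> = k * card J"
      using assms(3) that by (simp add: is_m_ovoid_def)
    finally show ?thesis .
  qed
  then show ?thesis
    using assms(3) by (auto simp: is_m_ovoid_def)
qed

lemma is_m_ovoid_two_ovoid: "is_m_ovoid 2 (two_ovoid x :: ('a ^ 8) set set)"
proof (cases x)
  case None
  then show ?thesis
    by (simp add: two_ovoid_def is_m_ovoid_sign)
next
  case (Some ab)
  obtain a b where ab: "ab = (a, b)"
    by (cases ab)
  \<comment> \<open>The parameter is written as a product to match the rule for unions: two ovoids
    with \<open>k = 1\<close>.\<close>
  have "is_m_ovoid (1 * card (UNIV :: bool set))
      (\<Union>c\<in>UNIV. points (signed_blocks (sign (a, b, c) :: _ \<Rightarrow> 'a) 6))"
    by (rule is_m_ovoid_UN)
      (simp_all add: disjoint_family_on_def points_signed_blocks_disjoint is_m_ovoid_sign)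
  then show ?thesis
    by (simp add: Some ab two_ovoid_def)
qed

lemma disjoint_family_two_ovoid: "disjoint_family_on (two_ovoid :: _ \<Rightarrow> ('a ^ 8) set set) J"
proof -
  have "two_ovoid x \<inter> two_ovoid y = ({} :: ('a ^ 8) set set)" if "x \<noteq> y" for x y
  proof -
    have 6: "a = b" if "p \<in> points (signed_blocks (sign a :: _ \<Rightarrow> 'a) 6)"
      "p \<in> points (signed_blocks (sign b :: _ \<Rightarrow> 'a) 6)" for p a b
      using points_signed_blocks_disjoint[of a b] that by blast
    have 36: False if "p \<in> points (signed_blocks (sign a :: _ \<Rightarrow> 'a) 3)"
      "p \<in> points (signed_blocks (sign b :: _ \<Rightarrow> 'a) 6)" for p a b
      using points_signed_blocks_disjoint'[of 3 6 a b] that by auto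
    have "x = y" if "p \<in> two_ovoid x" "p \<in> two_ovoid y" for p :: "('a ^ 8) set"
      using that unfolding two_ovoid_def
      by (cases x; cases y) (auto dest: 6 36)
    with \<open>x \<noteq> y\<close> show ?thesis
      by blast
  qed
  then show ?thesis
    by (simp add: disjoint_family_on_def)
qed

end

theorem theorem5p4:
  fixes m :: nat
  assumes "CARD('a::field) = 3"
    and "m \<in> {2, 4, 6, 8, 10}"
  shows "\<exists>S :: ('a ^ 8) set set. is_m_ovoid m S \<and>
           (\<exists>F. (\<forall>T\<in>F. is_m_ovoid 2 T) \<and> disjoint F \<and> S = \<Union>F)"
proof -
  \<comment> \<open>There are five disjoint 2-ovoids, and any \<open>m div 2\<close> of them
    serve.\<close>
  have "m = 2 * (m div 2)" "m div 2 \<le> CARD((bool \<times> bool) option)"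
    using assms(2) by auto
  then obtain J :: "(bool \<times> bool) option set" where J: "m = 2 * card J"
    by (metis obtain_subset_with_card_n)
  let ?F = "two_ovoid ` J :: ('a ^ 8) set set set"
  have "is_m_ovoid m (\<Union>?F)"
    unfolding J using is_m_ovoid_two_ovoid[OF assms(1)] disjoint_family_two_ovoid[OF assms(1)]
    by (intro is_m_ovoid_UN[OF assms(1)]) simp_all
  moreover have "\<forall>T\<in>?F. is_m_ovoid 2 T"
    using is_m_ovoid_two_ovoid[OF assms(1)] by blast
  moreover have "disjoint ?F"
    by (rule disjoint_family_on_disjoint_image[OF disjoint_family_two_ovoid[OF assms(1)]])
  ultimately show ?thesis
    by blast
qed

end
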